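(* A non-autonomous system $(X,f_{1,\infty})$ has the weak specification property (WSP) if and only if $(\mathcal{K}(X),\overline{f}_{1,\infty})$ has WSP.
   Context: A non-autonomous (discrete) system $(X,f_{1,\infty})$ consists of a compact metric space $(X,d)$ and a sequence $f_{1,\infty}=(f_n)_{n\ge 1}$ of continuous surjective maps $f_n:X\to X$. Write $\mathbb{N}=\{1,2,\dots\}$, $f_1^0=\mathrm{id}$ and $f_1^n=f_n\circ\cdots\circ f_1$ for $n\ge1$. $\mathcal{K}(X)$ is the space of non-empty compact subsets of $X$ with the Hausdorff metric $\mathcal{H}(A,B)=\inf\{\epsilon>0: A\subseteq N(B,\epsilon),\ B\subseteq N(A,\epsilon)\}$, where $N(A,\epsilon)=\bigcup_{a\in A}B_d(a,\epsilon)$ and $B_d(a,\epsilon)$ is the open ball. The induced system is $\overline{f}_{1,\infty}=(\overline{f}_n)_{n\ge1}$ with $\overline{f}_n(K)=f_n(K)$ for $K\in\mathcal{K}(X)$. WSP for $(X,f_{1,\infty})$: for every $\epsilon>0$ there is $N\in\mathbb{N}$ such that for every $s\in\mathbb{N}$, every choice of points $x_1,\dots,x_s\in X$ and every sequence $a_1\le b_1<a_2\le b_2<\cdots<a_s\le b_s$ of non-negative integers with $a_j-b_{j-1}>N$ for $2\le j\le s$, there is $z\in X$ with $d(f_1^j(z),f_1^j(x_i))<\epsilon$ for all $a_i\le j\le b_i$, $1\le i\le s$. For $(\mathcal{K}(X),\overline{f}_{1,\infty})$ the same definition is used with the metric $\mathcal{H}$. *)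

theory Defs
  imports "HOL-Analysis.Analysis"
begin

text \<open>
  A sequence of maps \<open>(f\<^sub>n)\<close> with \<open>n \<ge> 1\<close> is a function on \<open>nat\<close> whose value at \<open>0\<close> is
  never used.
\<close>

definition nonautonomous_system ::
  "'a set \<Rightarrow> ('a \<Rightarrow> 'a \<Rightarrow> real) \<Rightarrow> (nat \<Rightarrow> 'a \<Rightarrow> 'a) \<Rightarrow> bool" where
  "nonautonomous_system X d f \<longleftrightarrow>
     Metric_space X d \<and>
     compact_space (Metric_space.mtopology X d) \<and>
     (\<forall>n\<ge>1. continuous_map (Metric_space.mtopology X d) (Metric_space.mtopology X d) (f n) \<and>
            f n ` X = X)"

primrec orbit_map :: "(nat \<Rightarrow> 'a \<Rightarrow> 'a) \<Rightarrow> nat \<Rightarrow> 'a \<Rightarrow> 'a" where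
  "orbit_map f 0 = id"
| "orbit_map f (Suc n) = f (Suc n) \<circ> orbit_map f n"

definition WSP :: "'a set \<Rightarrow> ('a \<Rightarrow> 'a \<Rightarrow> real) \<Rightarrow> (nat \<Rightarrow> 'a \<Rightarrow> 'a) \<Rightarrow> bool" where
  "WSP X d f \<longleftrightarrow>
     (\<forall>\<epsilon>>0. \<exists>N\<ge>1. \<forall>s\<ge>1. \<forall>(x :: nat \<Rightarrow> 'a) (a :: nat \<Rightarrow> nat) (b :: nat \<Rightarrow> nat).
        (\<forall>i\<in>{1..s}. x i \<in> X) \<and>
        (\<forall>i\<in>{1..s}. a i \<le> b i) \<and>
        (\<forall>j\<in>{2..s}. b (j - 1) < a j \<and> a j - b (j - 1) > N) \<longrightarrow>
        (\<exists>z\<in>X. \<forall>i\<in>{1..s}. \<forall>j\<in>{a i..b i}.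
           d (orbit_map f j z) (orbit_map f j (x i)) < \<epsilon>))"

definition hyperspace :: "'a set \<Rightarrow> ('a \<Rightarrow> 'a \<Rightarrow> real) \<Rightarrow> 'a set set" where
  "hyperspace X d = {K. K \<noteq> {} \<and> compactin (Metric_space.mtopology X d) K}"

definition nbhd :: "'a set \<Rightarrow> ('a \<Rightarrow> 'a \<Rightarrow> real) \<Rightarrow> 'a set \<Rightarrow> real \<Rightarrow> 'a set" where
  "nbhd X d A \<epsilon> = (\<Union>a\<in>A. Metric_space.mball X d a \<epsilon>)"

text \<open>
  For non-empty compact arguments the set below is non-empty and bounded below by \<open>0\<close>, so that
  the real-valued \<open>Inf\<close> is the actual infimum; other arguments are not used.
\<close>

definition hausdorff_metric ::
  "'a set \<Rightarrow> ('a \<Rightarrow> 'a \<Rightarrow> real) \<Rightarrow> 'a set \<Rightarrow> 'a set \<Rightarrow> real" where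
  "hausdorff_metric X d A B = Inf {\<epsilon>. \<epsilon> > 0 \<and> A \<subseteq> nbhd X d B \<epsilon> \<and> B \<subseteq> nbhd X d A \<epsilon>}"

definition induced_maps :: "(nat \<Rightarrow> 'a \<Rightarrow> 'a) \<Rightarrow> nat \<Rightarrow> 'a set \<Rightarrow> 'a set" where
  "induced_maps f n K = f n ` K"

end

theory Submission
  imports Defs
begin

text \<open>
  Given compact sets \<open>K\<^sub>1, \<dots>, K\<^sub>s\<close>, collect all points of \<open>X\<close> whose orbit traces, up to
  \<open>\<epsilon>/2\<close>, some tuple \<open>(x\<^sub>1, \<dots>, x\<^sub>s)\<close> with \<open>x\<^sub>i \<in> K\<^sub>i\<close>. The closure of this set is compact, and by
  continuity it traces \<open>(K\<^sub>1, \<dots>, K\<^sub>s)\<close> up to \<open>3\<epsilon>/4\<close> in the Hausdorff metric; taking the closure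
  avoids any approximation of the \<open>K\<^sub>i\<close> by finite sets. Conversely, if a compact set traces the
  singletons \<open>{x\<^sub>i}\<close>, then so does each of its points.
\<close>

lemma orbit_map_induced_maps: "orbit_map (induced_maps f) n K = orbit_map f n ` K"
  by (induction n) (auto simp: induced_maps_def image_image)

lemma continuous_map_orbit_map:
  assumes "nonautonomous_system X d f"
  shows "continuous_map (Metric_space.mtopology X d) (Metric_space.mtopology X d) (orbit_map f n)"
proof (induction n)
  case (Suc n)
  have "continuous_map (Metric_space.mtopology X d) (Metric_space.mtopology X d) (f (Suc n))"
    using assms by (simp add: nonautonomous_system_def)
  with Suc show ?case
    unfolding orbit_map.simps by (rule continuous_map_compose)
qed (simp add: id_def)

text \<open>Both directions apply the tracing property of one fixed \<open>N\<close> to tuples built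
  inside the proof; as a rule it can be instantiated directly.\<close>

lemma WSP_obtain:
  assumes "WSP X d f" "\<epsilon> > 0"
  obtains N where "N \<ge> 1"
    and "\<And>s x a (b :: nat \<Rightarrow> nat). s \<ge> 1 \<Longrightarrow>
        (\<forall>i\<in>{1..s}. x i \<in> X) \<and> (\<forall>i\<in>{1..s}. a i \<le> b i) \<and>
        (\<forall>j\<in>{2..s}. b (j - 1) < a j \<and> a j - b (j - 1) > N) \<Longrightarrow>
        \<exists>z\<in>X. \<forall>i\<in>{1..s}. \<forall>j\<in>{a i..b i}.
          d (orbit_map f j z) (orbit_map f j (x i)) < \<epsilon>"
  using assms(1)[unfolded WSP_def, THEN spec, THEN mp, OF assms(2)]
proof (elim exE conjE, goal_cases)
  case (1 N)
  show ?case
    by (rule 1(1)[OF 1(2)])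
      (rule 1(3)[THEN spec, THEN mp, THEN spec, THEN spec, THEN spec, THEN mp])
qed

context Metric_space
begin

lemma in_nbhd: "y \<in> nbhd M d A r \<longleftrightarrow> y \<in> M \<and> (\<exists>a\<in>A \<inter> M. d a y < r)"
  by (auto simp: nbhd_def)

lemma image_subset_nbhd:
  assumes "g ` A \<subseteq> M" "g ` B \<subseteq> M" "\<And>x. x \<in> A \<Longrightarrow> \<exists>y\<in>B. d (g y) (g x) < r"
  shows "g ` A \<subseteq> nbhd M d (g ` B) r"
  using assms unfolding image_subset_iff in_nbhd by blast

lemma hausdorff_metric_le:
  assumes "r > 0" "A \<subseteq> nbhd M d B r" "B \<subseteq> nbhd M d A r"
  shows "hausdorff_metric M d A B \<le> r"
  unfolding hausdorff_metric_def using assms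
  by (intro cInf_lower bdd_belowI[of _ 0]) auto

text \<open>Boundedness makes the set of admissible radii non-empty; the \<open>Inf\<close> of an
  empty set of reals would carry no information. An infimum below \<open>r\<close> then yields an
  admissible radius \<open>e < r\<close>, and neighbourhoods grow with the radius.\<close>

lemma hausdorff_metric_lessD:
  assumes "mbounded M" "A \<subseteq> M" "B \<subseteq> M" "A \<noteq> {}" "B \<noteq> {}"
    and less: "hausdorff_metric M d A B < r"
  shows "A \<subseteq> nbhd M d B r"
proof -
  obtain c where c: "\<And>x y. x \<in> M \<Longrightarrow> y \<in> M \<Longrightarrow> d x y < c" "c > 0"
  proof -
    obtain b where "b > 0" "\<And>x y. x \<in> M \<Longrightarrow> y \<in> M \<Longrightarrow> d x y \<le> b"
      using assms(1) unfolding mbounded_alt_pos by blast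
    then show ?thesis
      \<comment> \<open>The weak bound \<open>b\<close> becomes a strict one, as open balls
        demand.\<close>
      using that[of "b + 1"] by fastforce
  qed
  have "C \<subseteq> nbhd M d D c" if "C \<subseteq> M" "D \<subseteq> M" "D \<noteq> {}" for C D
  proof
    fix x assume "x \<in> C"
    moreover obtain y where "y \<in> D"
      using \<open>D \<noteq> {}\<close> by blast
    ultimately show "x \<in> nbhd M d D c"
      using that c(1) unfolding in_nbhd by blast
  qed
  then have "c \<in> {\<epsilon>. \<epsilon> > 0 \<and> A \<subseteq> nbhd M d B \<epsilon> \<and> B \<subseteq> nbhd M d A \<epsilon>}"
    using assms(2-5) c(2) by simp
  then obtain e where "e < r" "A \<subseteq> nbhd M d B e"
    using cInf_lessD[OF _ less[unfolded hausdorff_metric_def]] by blast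
  then show ?thesis
    by (meson in_nbhd less_trans subset_iff)
qed

end

lemma WSP_hyperspace_imp_WSP:
  assumes sys: "nonautonomous_system X d f"
    and wsp: "WSP (hyperspace X d) (hausdorff_metric X d) (induced_maps f)"
  shows "WSP X d f"
proof -
  interpret Metric_space X d
    using sys by (simp add: nonautonomous_system_def)
  have bounded: "mbounded X"
    using sys compactin_imp_mbounded[of X]
    by (simp add: nonautonomous_system_def compact_space_def)
  have orbit_in: "orbit_map f n u \<in> X" if "u \<in> X" for n u
    using continuous_map_orbit_map[OF sys, of n] that by (auto simp: continuous_map_def)
  show ?thesis
    unfolding WSP_def
  proof (intro allI impI, goal_cases)
    case (1 \<epsilon>)
    show ?case
    proof (rule WSP_obtain[OF wsp 1], goal_cases)
      case N: (1 N)
      show ?case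
      proof (intro exI[of _ N] conjI allI impI N(1), goal_cases)
        case (1 s x a b)
        then have "\<forall>i\<in>{1..s}. {x i} \<in> hyperspace X d"
          by (simp add: hyperspace_def)
        with 1 have "\<exists>K\<in>hyperspace X d. \<forall>i\<in>{1..s}. \<forall>j\<in>{a i..b i}.
            hausdorff_metric X d (orbit_map f j ` K) {orbit_map f j (x i)} < \<epsilon>"
          using N(2)[of s "\<lambda>i. {x i}" a b] by (simp add: orbit_map_induced_maps)
        then obtain K where K: "K \<in> hyperspace X d"
          and tr: "\<And>i j. i \<in> {1..s} \<Longrightarrow> j \<in> {a i..b i} \<Longrightarrow>
            hausdorff_metric X d (orbit_map f j ` K) {orbit_map f j (x i)} < \<epsilon>"
          by blast
        have "K \<subseteq> X" "K \<noteq> {}"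
          using K compactin_subset_topspace by (fastforce simp: hyperspace_def)+
        then obtain z where z: "z \<in> K" "z \<in> X"
          by blast
        have "d (orbit_map f j z) (orbit_map f j (x i)) < \<epsilon>"
          if ij: "i \<in> {1..s}" "j \<in> {a i..b i}" for i j
        proof -
          \<comment> \<open>The neighbourhood of a singleton is a ball, so the choice of
            \<open>z\<close> in \<open>K\<close> is arbitrary and does not depend on
            \<open>i\<close> or \<open>j\<close>.\<close>
          have "orbit_map f j ` K \<subseteq> nbhd X d {orbit_map f j (x i)} \<epsilon>"
            using 1 ij \<open>K \<subseteq> X\<close> \<open>K \<noteq> {}\<close>
            by (intro hausdorff_metric_lessD bounded tr) (auto intro: orbit_in)
          then show ?thesis
            using z by (auto simp: in_nbhd commute)
        qed
        with z show ?case
          by blast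
      qed
    qed
  qed
qed

lemma WSP_imp_WSP_hyperspace:
  assumes sys: "nonautonomous_system X d f" and wsp: "WSP X d f"
  shows "WSP (hyperspace X d) (hausdorff_metric X d) (induced_maps f)"
proof -
  interpret Metric_space X d
    using sys by (simp add: nonautonomous_system_def)
  have orbit_in: "orbit_map f n u \<in> X" if "u \<in> X" for n u
    using continuous_map_orbit_map[OF sys, of n] that by (auto simp: continuous_map_def)
  show ?thesis
    unfolding WSP_def
  proof (intro allI impI, goal_cases)
    case (1 \<epsilon>)
    \<comment> \<open>Error budget: \<epsilon>/2 for tracing and \<epsilon>/4 for passing to the
      closure. The remaining \<epsilon>/4 restores strictness, since
      \<open>hausdorff_metric_le\<close> gives only a weak inequality.\<close>
    then have half: "\<epsilon> / 2 > 0"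
      by simp
    show ?case
    proof (rule WSP_obtain[OF wsp half], goal_cases)
      case N: (1 N)
      show ?case
      proof (intro exI[of _ N] conjI allI impI N(1), goal_cases)
        case (1 s K a b)
        define traces where "traces = (\<lambda>z x. \<forall>i\<in>{1..s}. \<forall>j\<in>{a i..b i}.
          d (orbit_map f j z) (orbit_map f j (x i)) < \<epsilon> / 2)"
        \<comment> \<open>The tuple may vary with \<open>z\<close>: no single point has to trace all
          of \<open>K i\<close>.\<close>
        define Z where "Z = {z \<in> X. \<exists>x. (\<forall>i\<in>{1..s}. x i \<in> K i) \<and> traces z x}"
        define C where "C = mtopology closure_of Z"
        have K: "K i \<subseteq> X" "K i \<noteq> {}" if "i \<in> {1..s}" for i
          using 1 that compactin_subset_topspace by (fastforce simp: hyperspace_def)+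
        have Z_hits: "\<exists>z\<in>Z. \<forall>j\<in>{a i..b i}. d (orbit_map f j z) (orbit_map f j y) < \<epsilon> / 2"
          if i: "i \<in> {1..s}" and y: "y \<in> K i" for i y
        proof -
          \<comment> \<open>Only entry \<open>i\<close> is prescribed; the others are arbitrary
            points of the non-empty sets \<open>K k\<close>.\<close>
          define x where "x = (\<lambda>k. if k = i then y else SOME u. u \<in> K k)"
          have x: "x k \<in> K k" if "k \<in> {1..s}" for k
            using K[OF that] y by (simp add: x_def some_in_eq)
          have "\<forall>i\<in>{1..s}. x i \<in> X"
            using x K by blast
          then obtain z where "z \<in> X" "traces z x"
            using N(2)[of s x a b] 1 unfolding traces_def by blast
          moreover have "z \<in> Z"
            using calculation x unfolding Z_def by blast
          moreover have "x i = y"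
            by (simp add: x_def)
          ultimately show ?thesis
            using i unfolding traces_def by metis
        qed
        have "Z \<subseteq> C" "C \<subseteq> X"
          using closure_of_subset[of Z mtopology] closure_of_subset_topspace[of mtopology Z]
          by (auto simp: C_def Z_def)
        have "Z \<noteq> {}"
          \<comment> \<open>Index 1 is available because \<open>s \<ge> 1\<close>.\<close>
          using Z_hits[of 1] K[of 1] 1 by fastforce
        have "compactin mtopology C"
          using sys by (simp add: C_def closedin_compact_space nonautonomous_system_def)
        then have "C \<in> hyperspace X d"
          using \<open>Z \<noteq> {}\<close> \<open>Z \<subseteq> C\<close> by (auto simp: hyperspace_def)
        moreover have "hausdorff_metric X d (orbit_map f j ` C) (orbit_map f j ` K i) < \<epsilon>"
          if ij: "i \<in> {1..s}" "j \<in> {a i..b i}" for i j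
        proof -
          have in_X: "orbit_map f j ` C \<subseteq> X" "orbit_map f j ` K i \<subseteq> X"
            using K(1)[OF ij(1)] \<open>C \<subseteq> X\<close> orbit_in by blast+
          have "\<exists>y\<in>K i. d (orbit_map f j y) (orbit_map f j w) < 3 * \<epsilon> / 4" if w: "w \<in> C" for w
          proof -
            \<comment> \<open>A continuous map sends the closure of \<open>Z\<close> into the
              closure of its image. The resulting \<open>z\<close> may depend on \<open>j\<close>,
              because the Hausdorff estimate is made separately for each time.\<close>
            have "orbit_map f j w \<in> mtopology closure_of (orbit_map f j ` Z)"
              using continuous_map_image_closure_subset[OF continuous_map_orbit_map[OF sys, of j]] w
              unfolding C_def by blast
            moreover have "\<epsilon> / 4 > 0"
              using \<open>\<epsilon> > 0\<close> by simp
            ultimately obtain z where z: "z \<in> Z" "d (orbit_map f j w) (orbit_map f j z) < \<epsilon> / 4"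
              unfolding metric_closure_of mem_Collect_eq bex_simps in_mball by blast
            \<comment> \<open>\<open>y\<close> is entry \<open>i\<close> of a tuple that
              \<open>z\<close> traces.\<close>
            obtain y where y: "y \<in> K i" "d (orbit_map f j z) (orbit_map f j y) < \<epsilon> / 2"
              using z ij unfolding Z_def traces_def by blast
            have "w \<in> X" "z \<in> X" "y \<in> X"
              using w z y K ij \<open>C \<subseteq> X\<close> \<open>Z \<subseteq> C\<close> by blast+
            then have "d (orbit_map f j w) (orbit_map f j y)
                \<le> d (orbit_map f j w) (orbit_map f j z) + d (orbit_map f j z) (orbit_map f j y)"
              by (intro triangle orbit_in)
            with y z show ?thesis
              by (auto simp: commute intro!: bexI[of _ y])
          qed
          then have C_near: "orbit_map f j ` C \<subseteq> nbhd X d (orbit_map f j ` K i) (3 * \<epsilon> / 4)"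
            by (intro image_subset_nbhd in_X)
          \<comment> \<open>Here \<epsilon>/2 suffices, as the tracing point lies in
            \<open>Z\<close> itself; the larger radius matches the other inclusion.\<close>
          have "\<exists>z\<in>C. d (orbit_map f j z) (orbit_map f j y) < 3 * \<epsilon> / 4" if y: "y \<in> K i" for y
          proof -
            obtain z where "z \<in> Z" "d (orbit_map f j z) (orbit_map f j y) < \<epsilon> / 2"
              using Z_hits[OF ij(1) y] ij by blast
            then show ?thesis
              using \<open>Z \<subseteq> C\<close> \<open>\<epsilon> > 0\<close> by (intro bexI[of _ z]) auto
          qed
          then have "orbit_map f j ` K i \<subseteq> nbhd X d (orbit_map f j ` C) (3 * \<epsilon> / 4)"
            by (intro image_subset_nbhd in_X)
          with C_near have "hausdorff_metric X d (orbit_map f j ` C) (orbit_map f j ` K i) \<le> 3 * \<epsilon> / 4"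
            using \<open>\<epsilon> > 0\<close> by (intro hausdorff_metric_le) auto
          then show ?thesis
            using \<open>\<epsilon> > 0\<close> by simp
        qed
        ultimately show ?case
          unfolding orbit_map_induced_maps by blast
      qed
    qed
  qed
qed

theorem theorem5p2:
  fixes X :: "'a set" and d :: "'a \<Rightarrow> 'a \<Rightarrow> real" and f :: "nat \<Rightarrow> 'a \<Rightarrow> 'a"
  assumes "nonautonomous_system X d f"
  shows "WSP X d f \<longleftrightarrow> WSP (hyperspace X d) (hausdorff_metric X d) (induced_maps f)"
  using WSP_imp_WSP_hyperspace[OF assms] WSP_hyperspace_imp_WSP[OF assms] by blast

end
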